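(* Let $(X_1,\ldots,X_d)\in M_n(\mathbb{C})^d$. For every integer $k\ge1$, $$\frac{1}{\sqrt[2k]{d}}\,\hat{\rho}(X_1^{\otimes k},\ldots,X_d^{\otimes k})^{1/k}\le\rho(X_1,\ldots,X_d)\le\hat{\rho}(X_1^{\otimes k},\ldots,X_d^{\otimes k})^{1/k}.$$ Namely, $$\rho(X_1,\ldots,X_d)=\lim_{k\to\infty}\hat{\rho}(X_1^{\otimes k},\ldots,X_d^{\otimes k})^{1/k}.$$
   Context: For a single square matrix, $\rho$ denotes the spectral radius. For a tuple, $\rho(X_1,\ldots,X_d)$ denotes the joint spectral radius $$\rho(X_1,\ldots,X_d)=\lim_{k\to\infty}\sup_{1\le i_1,\ldots,i_k\le d}\|X_{i_1}\cdots X_{i_k}\|^{1/k},$$ with $\|\cdot\|$ the operator norm. The outer spectral radius of a tuple of square matrices of equal size is $\hat{\rho}(Y_1,\ldots,Y_d)=\sqrt{\rho(\sum_{i=1}^d\overline{Y_i}\otimes Y_i)}$, where $\overline{A}$ is the entrywise complex conjugate and $\otimes$ is the Kronecker product. $A^{\otimes k}$ is the $k$-fold Kronecker power of $A$. *)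

theory Defs
  imports "Jordan_Normal_Form.Spectral_Radius" "HOL-Analysis.L2_Norm"
begin

text \<open>Row index \<open>i\<close> of a Kronecker product stands for the pair
  \<open>(i div dim_row B, i mod dim_row B)\<close>, and likewise for columns, so that the
  \<open>(a, b)\<close> block of \<open>kronecker A B\<close> is the \<open>(a, b)\<close> entry of \<open>A\<close> times \<open>B\<close>.\<close>

definition kronecker :: "complex mat \<Rightarrow> complex mat \<Rightarrow> complex mat" where
  "kronecker A B =
     mat (dim_row A * dim_row B) (dim_col A * dim_col B)
       (\<lambda>(i, j). A $$ (i div dim_row B, j div dim_col B) * B $$ (i mod dim_row B, j mod dim_col B))"

fun kronecker_power :: "complex mat \<Rightarrow> nat \<Rightarrow> complex mat" where
  "kronecker_power A 0 = 1\<^sub>m 1"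
| "kronecker_power A (Suc k) = kronecker A (kronecker_power A k)"

lemma kronecker_carrier [simp]:
  "A \<in> carrier_mat n m \<Longrightarrow> B \<in> carrier_mat p q \<Longrightarrow> kronecker A B \<in> carrier_mat (n * p) (m * q)"
  by (auto simp: kronecker_def)

lemma kronecker_power_carrier [simp]:
  "A \<in> carrier_mat n m \<Longrightarrow> kronecker_power A k \<in> carrier_mat (n ^ k) (m ^ k)"
  by (induction k) auto

lemma kronecker_power_one: "kronecker_power A 1 = A"
  by (rule eq_matI) (auto simp: kronecker_def)

definition euclidean_norm_vec :: "complex vec \<Rightarrow> real" where
  "euclidean_norm_vec v = L2_set (\<lambda>i. cmod (v $ i)) {..<dim_vec v}"

definition operator_norm :: "complex mat \<Rightarrow> real" where
  "operator_norm A =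
     (SUP v \<in> {v \<in> carrier_vec (dim_col A). euclidean_norm_vec v \<le> 1}. euclidean_norm_vec (A *\<^sub>v v))"

text \<open>A tuple of \<open>n \<times> n\<close> matrices is a list; its dimension \<open>n\<close> is passed explicitly
  because it is needed for the empty product and for the zero of the sum.
  A word is a list of indices into the tuple.\<close>

definition word_product :: "nat \<Rightarrow> complex mat list \<Rightarrow> nat list \<Rightarrow> complex mat" where
  "word_product n Xs w = foldr (\<lambda>i P. Xs ! i * P) w (1\<^sub>m n)"

text \<open>The limit exists for every nonempty tuple, by submultiplicativity of the suprema
  (Fekete's lemma).\<close>

definition joint_spectral_radius :: "nat \<Rightarrow> complex mat list \<Rightarrow> real" where
  "joint_spectral_radius n Xs =
     lim (\<lambda>k. SUP w \<in> {w. length w = k \<and> set w \<subseteq> {..<length Xs}}.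
                root k (operator_norm (word_product n Xs w)))"

definition outer_spectral_radius :: "nat \<Rightarrow> complex mat list \<Rightarrow> real" where
  "outer_spectral_radius n Ys =
     sqrt (spectral_radius
       (foldr (+) (map (\<lambda>Y. kronecker (map_mat cnj Y) Y) Ys) (0\<^sub>m (n * n) (n * n))))"

end

theory Submission
  imports Defs
begin

text \<open>Let \<open>S\<^sub>k = (\<Sum>X\<leftarrow>Xs. cnj (X\<^sup>\<otimes>\<^sup>k) \<otimes> X\<^sup>\<otimes>\<^sup>k)\<close>. By the mixed product rule, \<open>S\<^sub>k\<^sup>m\<close> is the sum of
  \<open>cnj (W\<^sup>\<otimes>\<^sup>k) \<otimes> W\<^sup>\<otimes>\<^sup>k\<close> over all words \<open>W\<close> of length \<open>m\<close>. The sum of the moduli of the entries is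
  multiplicative under \<open>\<otimes>\<close>, so \<open>\<rho>(S\<^sub>k)\<^sup>m\<close> is at most \<open>d\<^sup>m\<close> times the \<open>2k\<close>-th power of the largest
  norm of a word, up to a constant independent of \<open>m\<close>. Conversely, each \<open>\<bar>W\<^sub>p\<^sub>q\<bar>\<^sup>2\<^sup>k\<close> is one of the
  nonnegative summands of a suitable entry of \<open>S\<^sub>k\<^sup>m\<close>, which grows at most like \<open>(\<rho>(S\<^sub>k) + \<epsilon>)\<^sup>m\<close>.
  Letting \<open>k\<close> tend to infinity, the two bounds also give convergence of the sequence that
  defines the joint spectral radius, without Fekete's lemma.\<close>

section \<open>Entries of products and Kronecker products\<close>

lemma index_mult_mat_sum:
  assumes "A \<in> carrier_mat n m" "B \<in> carrier_mat m p" "i < n" "j < p"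
  shows "(A * B) $$ (i, j) = (\<Sum>l<m. A $$ (i, l) * B $$ (l, j))"
  using assms by (auto simp: scalar_prod_def atLeast0LessThan intro!: sum.cong)

lemma index_mult_mat_vec_sum:
  assumes "A \<in> carrier_mat n m" "v \<in> carrier_vec m" "i < n"
  shows "(A *\<^sub>v v) $ i = (\<Sum>j<m. A $$ (i, j) * v $ j)"
proof -
  have "(A *\<^sub>v v) $ i = row A i \<bullet> v"
    using assms by simp
  also have "\<dots> = (\<Sum>j<m. row A i $ j * v $ j)"
    unfolding scalar_prod_def carrier_vecD[OF assms(2)] atLeast0LessThan ..
  also have "\<dots> = (\<Sum>j<m. A $$ (i, j) * v $ j)"
    using assms by (intro sum.cong) simp_all
  finally show ?thesis .
qed

text \<open>Kronecker indices code pairs by quotient and remainder; this reindexing turns sums over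
  such indices into double sums. \<open>sum.nat_group\<close> cuts the range into \<open>a\<close>
  blocks of length \<open>b\<close>, on each of which the quotient is constant. For
  \<open>b = 0\<close> both sides are empty sums.\<close>

lemma sum_div_mod:
  fixes f :: "nat \<Rightarrow> nat \<Rightarrow> 'a::comm_monoid_add"
  shows "(\<Sum>i<a * b. f (i div b) (i mod b)) = (\<Sum>i<a. \<Sum>j<b. f i j)"
proof -
  have "(\<Sum>i<a * b. f (i div b) (i mod b)) = (\<Sum>k<a. \<Sum>i=k * b..<k * b + b. f (i div b) (i mod b))"
    by (rule sum.nat_group[symmetric])
  also have "\<dots> = (\<Sum>k<a. \<Sum>j=0..<b. f ((j + k * b) div b) ((j + k * b) mod b))"
  proof (rule sum.cong[OF refl])
    fix k
    show "(\<Sum>i=k * b..<k * b + b. f (i div b) (i mod b))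
        = (\<Sum>j=0..<b. f ((j + k * b) div b) ((j + k * b) mod b))"
      using sum.shift_bounds_nat_ivl[of "\<lambda>i. f (i div b) (i mod b)" 0 "k * b" b]
      by (simp only: add_0 add.commute[of b])
  qed
  also have "\<dots> = (\<Sum>k<a. \<Sum>j<b. f k j)"
    unfolding atLeast0LessThan
  proof (intro sum.cong[OF refl])
    fix k j
    assume "j \<in> {..<b}"
    then have "(j + k * b) div b = k" "(j + k * b) mod b = j" by simp_all
    then show "f ((j + k * b) div b) ((j + k * b) mod b) = f k j" by (simp only:)
  qed
  finally show ?thesis .
qed

lemma div_mod_less:
  fixes i n p :: nat
  assumes "i < n * p"
  shows "i div p < n \<and> i mod p < p"
  using assms by (cases "p = 0") (auto simp: less_mult_imp_div_less)

lemma index_kronecker: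
  assumes "A \<in> carrier_mat n m" "B \<in> carrier_mat p q" "i < n * p" "j < m * q"
  shows "kronecker A B $$ (i, j) = A $$ (i div p, j div q) * B $$ (i mod p, j mod q)"
  unfolding kronecker_def carrier_matD[OF assms(1)] carrier_matD[OF assms(2)]
  using assms(3,4) by (simp only: index_mat prod.case)

text \<open>The converse reading of \<open>index_kronecker\<close>: it builds the index from a
  chosen pair, which is what exhibiting a particular entry requires.\<close>

lemma index_kronecker_block:
  assumes "A \<in> carrier_mat n m" "B \<in> carrier_mat p q" "i < n" "j < m" "i' < p" "j' < q"
  shows "i * p + i' < n * p" "j * q + j' < m * q"
    "kronecker A B $$ (i * p + i', j * q + j') = A $$ (i, j) * B $$ (i', j')"
proof -
  have lt: "a * c + b < e * c" if "a < e" "b < c" for a b c e :: nat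
  proof -
    have "a * c + b < Suc a * c" using that by simp
    also have "\<dots> \<le> e * c" using that by (intro mult_right_mono) auto
    finally show ?thesis .
  qed
  show i: "i * p + i' < n * p" and j: "j * q + j' < m * q"
    by (rule lt[OF assms(3,5)], rule lt[OF assms(4,6)])
  have div_mod: "(i * p + i') div p = i" "(i * p + i') mod p = i'"
    "(j * q + j') div q = j" "(j * q + j') mod q = j'"
    using assms(5,6) by simp_all
  show "kronecker A B $$ (i * p + i', j * q + j') = A $$ (i, j) * B $$ (i', j')"
    unfolding index_kronecker[OF assms(1,2) i j] div_mod by (rule refl)
qed

text \<open>The mixed product rule. The inner index \<open>l < m * q\<close> codes a pair, so the
  sum over it becomes a double sum whose terms separate, and it factors into one entry of each
  product.\<close>

lemma kronecker_mult:
  assumes A: "A \<in> carrier_mat n m" and B: "B \<in> carrier_mat p q"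
    and C: "C \<in> carrier_mat m r" and D: "D \<in> carrier_mat q s"
  shows "kronecker (A * C) (B * D) = kronecker A B * kronecker C D"
proof (rule eq_matI)
  have AB: "kronecker A B \<in> carrier_mat (n * p) (m * q)"
    and CD: "kronecker C D \<in> carrier_mat (m * q) (r * s)"
    and AC: "A * C \<in> carrier_mat n r" and BD: "B * D \<in> carrier_mat p s"
    using assms by simp_all
  note L = carrier_matD[OF kronecker_carrier[OF AC BD]]
    and R = carrier_matD[OF mult_carrier_mat[OF AB CD]]
  show "dim_row (kronecker (A * C) (B * D)) = dim_row (kronecker A B * kronecker C D)"
    "dim_col (kronecker (A * C) (B * D)) = dim_col (kronecker A B * kronecker C D)"
    by (simp_all only: L R)
  fix i j
  assume "i < dim_row (kronecker A B * kronecker C D)"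
    and "j < dim_col (kronecker A B * kronecker C D)"
  then have i: "i < n * p" and j: "j < r * s"
    by (simp_all only: R)
  have ip: "i div p < n" "i mod p < p"
    using div_mod_less[OF i] by auto
  have js: "j div s < r" "j mod s < s"
    using div_mod_less[OF j] by auto
  have "(kronecker A B * kronecker C D) $$ (i, j)
      = (\<Sum>l<m * q. kronecker A B $$ (i, l) * kronecker C D $$ (l, j))"
    by (rule index_mult_mat_sum[OF AB CD i j])
  also have "\<dots> = (\<Sum>l<m * q. (A $$ (i div p, l div q) * C $$ (l div q, j div s))
                          * (B $$ (i mod p, l mod q) * D $$ (l mod q, j mod s)))"
    by (intro sum.cong refl)
      (simp only: lessThan_iff index_kronecker[OF A B i] index_kronecker[OF C D _ j] ac_simps)
  also have "\<dots> = (\<Sum>a<m. \<Sum>b<q. (A $$ (i div p, a) * C $$ (a, j div s))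
                          * (B $$ (i mod p, b) * D $$ (b, j mod s)))"
    by (rule sum_div_mod)
  also have "\<dots> = (A * C) $$ (i div p, j div s) * (B * D) $$ (i mod p, j mod s)"
    unfolding index_mult_mat_sum[OF A C ip(1) js(1)] index_mult_mat_sum[OF B D ip(2) js(2)]
    by (rule sum_product[symmetric])
  also have "\<dots> = kronecker (A * C) (B * D) $$ (i, j)"
    by (rule index_kronecker[OF AC BD i j, symmetric])
  finally show "kronecker (A * C) (B * D) $$ (i, j) = (kronecker A B * kronecker C D) $$ (i, j)"
    by simp
qed

lemma kronecker_one: "kronecker (1\<^sub>m n) (1\<^sub>m m) = 1\<^sub>m (n * m)"
proof (rule eq_matI)
  fix i j
  assume ij: "i < dim_row (1\<^sub>m (n * m) :: complex mat)" "j < dim_col (1\<^sub>m (n * m) :: complex mat)"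
  then have lt: "i < n * m" "j < n * m" by simp_all
  note dm = div_mod_less[OF lt(1)] div_mod_less[OF lt(2)]
  have "i = j \<longleftrightarrow> i div m = j div m \<and> i mod m = j mod m"
    by (metis div_mult_mod_eq)
  then show "kronecker (1\<^sub>m n) (1\<^sub>m m) $$ (i, j) = 1\<^sub>m (n * m) $$ (i, j)"
    using dm lt by (simp add: index_kronecker[OF one_carrier_mat one_carrier_mat lt])
qed (simp_all only: carrier_matD[OF kronecker_carrier[OF one_carrier_mat one_carrier_mat]]
    carrier_matD[OF one_carrier_mat])

lemma kronecker_power_one_mat: "kronecker_power (1\<^sub>m n) k = 1\<^sub>m (n ^ k)"
  by (induction k) (auto simp: kronecker_one)

lemma kronecker_power_mult:
  assumes "A \<in> carrier_mat n m" "B \<in> carrier_mat m p"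
  shows "kronecker_power (A * B) k = kronecker_power A k * kronecker_power B k"
proof (induction k)
  case (Suc k)
  show ?case
    using Suc.IH assms
    by (simp add: kronecker_mult[OF _ kronecker_power_carrier _ kronecker_power_carrier])
qed simp

lemma map_mat_cnj_mult:
  assumes "A \<in> carrier_mat n m" "B \<in> carrier_mat m p"
  shows "map_mat cnj (A * B) = map_mat cnj A * map_mat cnj B"
proof -
  interpret semiring_hom cnj by unfold_locales auto
  show ?thesis by (rule mat_hom_mult[OF assms])
qed

lemma map_mat_cnj_one: "map_mat cnj (1\<^sub>m n) = 1\<^sub>m n"
  by (rule eq_matI) auto

text \<open>The witnesses are the numbers whose \<open>k\<close> digits are all \<open>p\<close> in
  base \<open>n\<close> and all \<open>q\<close> in base \<open>m\<close>; each Kronecker factor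
  then contributes the same entry.\<close>

lemma kronecker_power_entry:
  assumes A: "A \<in> carrier_mat n m" and "p < n" "q < m"
  shows "\<exists>i<n ^ k. \<exists>j<m ^ k. kronecker_power A k $$ (i, j) = A $$ (p, q) ^ k"
proof (induction k)
  case (Suc k)
  then obtain i j where ij: "i < n ^ k" "j < m ^ k"
    and eq: "kronecker_power A k $$ (i, j) = A $$ (p, q) ^ k" by blast
  note block = index_kronecker_block[OF A kronecker_power_carrier[OF A] assms(2,3) ij]
  show ?case
    using block eq by (intro exI[of _ "p * n ^ k + i"] exI[of _ "q * m ^ k + j"] conjI) auto
qed simp

section \<open>Words and powers of a sum of matrices\<close>

abbreviation words :: "nat \<Rightarrow> nat \<Rightarrow> nat list set" where
  "words d m \<equiv> {w. length w = m \<and> set w \<subseteq> {..<d}}"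

lemma finite_words: "finite (words d m)"
  using finite_lists_length_eq[of "{..<d}" m] by (simp add: conj_commute)

lemma card_words: "card (words d m) = d ^ m"
  using card_lists_length_eq[of "{..<d}" m] by (simp add: conj_commute)

lemma words_nonempty:
  assumes "1 \<le> d"
  shows "words d m \<noteq> {}"
proof -
  have "replicate m 0 \<in> words d m" using assms by auto
  then show ?thesis by blast
qed

lemma sum_words_Suc:
  "(\<Sum>w\<in>words d (Suc m). f w) = (\<Sum>a<d. \<Sum>w\<in>words d m. f (a # w))"
proof -
  have "words d (Suc m) = (\<lambda>(a, w). a # w) ` ({..<d} \<times> words d m)"
    by (auto simp: image_iff length_Suc_conv)
  then have "(\<Sum>w\<in>words d (Suc m). f w) = (\<Sum>x\<in>{..<d} \<times> words d m. f (fst x # snd x))"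
    by (simp only:) (subst sum.reindex, auto simp: inj_on_def case_prod_beta)
  then show ?thesis
    by (simp add: sum.cartesian_product case_prod_beta)
qed

lemma word_product_carrier:
  assumes "set Xs \<subseteq> carrier_mat n n" "set w \<subseteq> {..<length Xs}"
  shows "word_product n Xs w \<in> carrier_mat n n"
  using assms(2)
proof (induction w)
  case (Cons a w)
  then have "Xs ! a \<in> carrier_mat n n" using assms(1) nth_mem by auto
  with Cons show ?case by (auto simp: word_product_def)
qed (simp add: word_product_def)

text \<open>Meant for \<open>kronecker_square k\<close>: words in the transformed matrices become
  transforms of words in the original tuple.\<close>

lemma word_product_map:
  assumes Xs: "set Xs \<subseteq> carrier_mat n n" "set w \<subseteq> {..<length Xs}"
    and one: "f (1\<^sub>m n) = 1\<^sub>m N"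
    and mult: "\<And>A B. A \<in> carrier_mat n n \<Longrightarrow> B \<in> carrier_mat n n \<Longrightarrow> f (A * B) = f A * f B"
  shows "word_product N (map f Xs) w = f (word_product n Xs w)"
  using Xs(2)
proof (induction w)
  case Nil
  show ?case by (simp add: word_product_def one)
next
  case (Cons a w)
  then have w: "set w \<subseteq> {..<length Xs}" and a: "a < length Xs" by auto
  have "Xs ! a \<in> carrier_mat n n" using Xs(1) a nth_mem by auto
  from mult[OF this word_product_carrier[OF Xs(1) w]] show ?case
    using Cons.IH[OF w] a by (simp add: word_product_def)
qed

lemma sum_mat_list:
  assumes "set Zs \<subseteq> carrier_mat n n"
  shows "foldr (+) Zs (0\<^sub>m n n) \<in> carrier_mat n n"
    and "i < n \<Longrightarrow> j < n \<Longrightarrow> foldr (+) Zs (0\<^sub>m n n) $$ (i, j) = (\<Sum>a<length Zs. Zs ! a $$ (i, j))"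
proof -
  \<comment> \<open>Both claims go through one induction, because reading off an entry of
    \<open>Z\<close> plus the remaining sum requires the dimensions of that sum.\<close>
  have "foldr (+) Zs (0\<^sub>m n n) \<in> carrier_mat n n
    \<and> (i < n \<longrightarrow> j < n \<longrightarrow> foldr (+) Zs (0\<^sub>m n n) $$ (i, j) = (\<Sum>a<length Zs. Zs ! a $$ (i, j)))"
    using assms
  proof (induction Zs)
    case (Cons Z Zs)
    then have Z: "Z \<in> carrier_mat n n"
      and IH: "foldr (+) Zs (0\<^sub>m n n) \<in> carrier_mat n n"
      "i < n \<longrightarrow> j < n \<longrightarrow> foldr (+) Zs (0\<^sub>m n n) $$ (i, j) = (\<Sum>a<length Zs. Zs ! a $$ (i, j))"
      by auto
    then show ?case by (simp add: sum.lessThan_Suc_shift del: sum.lessThan_Suc)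
  qed simp
  then show "foldr (+) Zs (0\<^sub>m n n) \<in> carrier_mat n n"
    and "i < n \<Longrightarrow> j < n \<Longrightarrow> foldr (+) Zs (0\<^sub>m n n) $$ (i, j) = (\<Sum>a<length Zs. Zs ! a $$ (i, j))"
    by auto
qed

text \<open>\<open>pow_mat\<close> multiplies on the right, whereas \<open>word_product\<close> adds
  letters on the left; this reconciles the two.\<close>

lemma pow_mat_Suc_left:
  assumes "A \<in> carrier_mat n n"
  shows "A ^\<^sub>m Suc k = A * A ^\<^sub>m k"
proof (induction k)
  case (Suc k)
  have "A ^\<^sub>m Suc (Suc k) = (A * A ^\<^sub>m k) * A"
    by (simp only: pow_mat.simps(2)[of A "Suc k"] Suc.IH)
  also have "\<dots> = A * (A ^\<^sub>m k * A)"
    by (rule assoc_mult_mat[OF assms pow_carrier_mat[OF assms] assms])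
  finally show ?case by (simp only: pow_mat.simps(2)[of A k])
qed (use assms in simp)

lemma pow_smult_mat:
  fixes A :: "'a::comm_semiring_1 mat"
  assumes "A \<in> carrier_mat n n"
  shows "(c \<cdot>\<^sub>m A) ^\<^sub>m k = c ^ k \<cdot>\<^sub>m A ^\<^sub>m k"
proof (induction k)
  case 0
  show ?case using assms by (auto intro!: eq_matI)
next
  case (Suc k)
  have Ak: "A ^\<^sub>m k \<in> carrier_mat n n" using assms by simp
  show ?case
  proof (rule eq_matI)
    fix i j
    assume "i < dim_row (c ^ Suc k \<cdot>\<^sub>m A ^\<^sub>m Suc k)" "j < dim_col (c ^ Suc k \<cdot>\<^sub>m A ^\<^sub>m Suc k)"
    then have ij: "i < n" "j < n" using assms by auto
    have cA: "c \<cdot>\<^sub>m A \<in> carrier_mat n n" "c ^ k \<cdot>\<^sub>m A ^\<^sub>m k \<in> carrier_mat n n"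
      using assms Ak by auto
    have "((c \<cdot>\<^sub>m A) ^\<^sub>m Suc k) $$ (i, j)
        = (\<Sum>l<n. (c ^ k \<cdot>\<^sub>m A ^\<^sub>m k) $$ (i, l) * (c \<cdot>\<^sub>m A) $$ (l, j))"
      by (simp only: pow_mat.simps(2) Suc.IH index_mult_mat_sum[OF cA(2,1) ij])
    also have "\<dots> = c ^ Suc k * (\<Sum>l<n. (A ^\<^sub>m k) $$ (i, l) * A $$ (l, j))"
      unfolding sum_distrib_left
    proof (rule sum.cong[OF refl])
      fix l
      assume "l \<in> {..<n}"
      then have "(c ^ k \<cdot>\<^sub>m A ^\<^sub>m k) $$ (i, l) = c ^ k * (A ^\<^sub>m k) $$ (i, l)"
        "(c \<cdot>\<^sub>m A) $$ (l, j) = c * A $$ (l, j)"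
        using assms Ak ij by simp_all
      then show "(c ^ k \<cdot>\<^sub>m A ^\<^sub>m k) $$ (i, l) * (c \<cdot>\<^sub>m A) $$ (l, j)
          = c ^ Suc k * ((A ^\<^sub>m k) $$ (i, l) * A $$ (l, j))"
        by (simp add: mult_ac)
    qed
    also have "\<dots> = c ^ Suc k * (A ^\<^sub>m Suc k) $$ (i, j)"
      by (simp only: pow_mat.simps(2) index_mult_mat_sum[OF Ak assms ij])
    also have "\<dots> = (c ^ Suc k \<cdot>\<^sub>m A ^\<^sub>m Suc k) $$ (i, j)"
      by (rule index_smult_mat(1)[symmetric]) (simp_all only: ij carrier_matD[OF pow_carrier_mat[OF assms]])
    finally show "((c \<cdot>\<^sub>m A) ^\<^sub>m Suc k) $$ (i, j) = (c ^ Suc k \<cdot>\<^sub>m A ^\<^sub>m Suc k) $$ (i, j)" .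
  qed (use assms in auto)
qed

text \<open>Noncommutative expansion of a power of a sum: one summand is chosen from each factor,
  and the choices form a word. The induction splits off the leftmost letter.\<close>

lemma pow_sum_mat_list:
  assumes Zs: "set Zs \<subseteq> carrier_mat n n" and "i < n" "j < n"
  shows "(foldr (+) Zs (0\<^sub>m n n) ^\<^sub>m m) $$ (i, j)
       = (\<Sum>w\<in>words (length Zs) m. word_product n Zs w $$ (i, j))"
  using assms(2,3)
proof (induction m arbitrary: i j)
  case 0
  have "words (length Zs) 0 = {[]}" by auto
  then show ?case
    using 0 sum_mat_list(1)[OF Zs] by (simp add: word_product_def)
next
  case (Suc m)
  let ?S = "foldr (+) Zs (0\<^sub>m n n)" and ?W = "words (length Zs) m"
  have S: "?S \<in> carrier_mat n n" and Sm: "?S ^\<^sub>m m \<in> carrier_mat n n"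
    using sum_mat_list(1)[OF Zs] by auto
  have "(?S ^\<^sub>m Suc m) $$ (i, j) = (\<Sum>l<n. ?S $$ (i, l) * (?S ^\<^sub>m m) $$ (l, j))"
    unfolding pow_mat_Suc_left[OF S] by (rule index_mult_mat_sum[OF S Sm Suc.prems])
  also have "\<dots> = (\<Sum>l<n. \<Sum>a<length Zs. \<Sum>w\<in>?W. Zs ! a $$ (i, l) * word_product n Zs w $$ (l, j))"
    using Suc by (intro sum.cong) (auto simp: sum_mat_list(2)[OF Zs] sum_product)
  also have "\<dots> = (\<Sum>a<length Zs. \<Sum>l<n. \<Sum>w\<in>?W. Zs ! a $$ (i, l) * word_product n Zs w $$ (l, j))"
    by (rule sum.swap)
  also have "\<dots> = (\<Sum>a<length Zs. \<Sum>w\<in>?W. \<Sum>l<n. Zs ! a $$ (i, l) * word_product n Zs w $$ (l, j))"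
    by (intro sum.cong refl sum.swap)
  also have "\<dots> = (\<Sum>a<length Zs. \<Sum>w\<in>?W. word_product n Zs (a # w) $$ (i, j))"
  proof (intro sum.cong refl)
    fix a w
    assume "a \<in> {..<length Zs}" "w \<in> ?W"
    then have "Zs ! a \<in> carrier_mat n n" "word_product n Zs w \<in> carrier_mat n n"
      using Zs nth_mem word_product_carrier[OF Zs] by auto
    from index_mult_mat_sum[OF this Suc.prems]
    show "(\<Sum>l<n. Zs ! a $$ (i, l) * word_product n Zs w $$ (l, j)) = word_product n Zs (a # w) $$ (i, j)"
      by (simp add: word_product_def)
  qed
  also have "\<dots> = (\<Sum>w\<in>words (length Zs) (Suc m). word_product n Zs w $$ (i, j))"
    by (rule sum_words_Suc[symmetric])
  finally show ?case .
qed

section \<open>The entry sum norm\<close>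

text \<open>This norm is exactly multiplicative under Kronecker products and invariant under
  conjugation. It is compared with \<open>operator_norm\<close> only on the original
  \<open>n\<close> by \<open>n\<close> words, so the constants depend neither on the word length nor
  on \<open>k\<close>.\<close>

definition entry_norm :: "complex mat \<Rightarrow> real" where
  "entry_norm A = (\<Sum>i<dim_row A. \<Sum>j<dim_col A. cmod (A $$ (i, j)))"

lemma entry_norm_nonneg: "0 \<le> entry_norm A"
  by (auto simp: entry_norm_def intro!: sum_nonneg)

lemma entry_norm_kronecker: "entry_norm (kronecker A B) = entry_norm A * entry_norm B"
proof -
  define n m p q where dims: "n = dim_row A" "m = dim_col A" "p = dim_row B" "q = dim_col B"
  have A: "A \<in> carrier_mat n m" and B: "B \<in> carrier_mat p q"
    by (simp_all only: dims carrier_matI[OF refl refl])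
  have "entry_norm (kronecker A B)
      = (\<Sum>i<n * p. \<Sum>j<m * q. cmod (A $$ (i div p, j div q)) * cmod (B $$ (i mod p, j mod q)))"
    unfolding entry_norm_def carrier_matD[OF kronecker_carrier[OF A B]]
    by (intro sum.cong refl) (simp only: lessThan_iff index_kronecker[OF A B] norm_mult)
  also have "\<dots> = (\<Sum>i<n * p. \<Sum>a<m. \<Sum>b<q. cmod (A $$ (i div p, a)) * cmod (B $$ (i mod p, b)))"
    by (rule sum.cong[OF refl])
      (rule sum_div_mod[where f = "\<lambda>a b. cmod (A $$ (_, a)) * cmod (B $$ (_, b))"])
  also have "\<dots> = (\<Sum>c<n. \<Sum>e<p. \<Sum>a<m. \<Sum>b<q. cmod (A $$ (c, a)) * cmod (B $$ (e, b)))"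
    by (rule sum_div_mod[where f = "\<lambda>c e. \<Sum>a<m. \<Sum>b<q. cmod (A $$ (c, a)) * cmod (B $$ (e, b))"])
  also have "\<dots> = entry_norm A * entry_norm B"
    unfolding entry_norm_def carrier_matD[OF A] carrier_matD[OF B] by (simp only: sum_product)
  finally show ?thesis .
qed

lemma entry_norm_kronecker_power: "entry_norm (kronecker_power A k) = entry_norm A ^ k"
  by (induction k) (simp_all add: entry_norm_kronecker, simp add: entry_norm_def)

lemma entry_norm_cnj: "entry_norm (map_mat cnj A) = entry_norm A"
  by (simp add: entry_norm_def)

lemma entry_norm_le:
  assumes "A \<in> carrier_mat n m" "\<And>i j. i < n \<Longrightarrow> j < m \<Longrightarrow> cmod (A $$ (i, j)) \<le> c"
  shows "entry_norm A \<le> real (n * m) * c"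
proof -
  have "entry_norm A \<le> (\<Sum>i<n. \<Sum>j<m. c)"
    unfolding entry_norm_def carrier_matD[OF assms(1)] by (intro sum_mono assms(2)) auto
  then show ?thesis by (simp add: mult_ac)
qed

section \<open>Comparison of the entry sum norm with the operator norm\<close>

text \<open>Coordinates of a vector in the unit ball have modulus at most 1. Besides one half of the
  comparison, this gives the boundedness that makes the supremum in \<open>operator_norm\<close>
  meaningful.\<close>

lemma euclidean_norm_mult_le:
  assumes A: "A \<in> carrier_mat n m" and v: "v \<in> carrier_vec m" "euclidean_norm_vec v \<le> 1"
  shows "euclidean_norm_vec (A *\<^sub>v v) \<le> entry_norm A"
proof -
  have coord: "cmod (v $ j) \<le> 1" if "j < m" for j
    using member_le_L2_set[of "{..<m}" j "\<lambda>i. cmod (v $ i)"] that v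
    by (simp add: euclidean_norm_vec_def)
  have "euclidean_norm_vec (A *\<^sub>v v) \<le> (\<Sum>i<n. cmod ((A *\<^sub>v v) $ i))"
    using L2_set_le_sum_abs[of "\<lambda>i. cmod ((A *\<^sub>v v) $ i)" "{..<n}"] A
    by (simp add: euclidean_norm_vec_def)
  also have "\<dots> \<le> (\<Sum>i<n. \<Sum>j<m. cmod (A $$ (i, j)))"
  proof (rule sum_mono)
    fix i
    assume i: "i \<in> {..<n}"
    have "(A *\<^sub>v v) $ i = (\<Sum>j<m. A $$ (i, j) * v $ j)"
      using index_mult_mat_vec_sum[OF A v(1)] i by simp
    then have "cmod ((A *\<^sub>v v) $ i) \<le> (\<Sum>j<m. cmod (A $$ (i, j) * v $ j))"
      by (simp add: norm_sum)
    also have "\<dots> \<le> (\<Sum>j<m. cmod (A $$ (i, j)))"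
      using coord by (intro sum_mono) (auto simp: norm_mult intro: mult_left_le)
    finally show "cmod ((A *\<^sub>v v) $ i) \<le> (\<Sum>j<m. cmod (A $$ (i, j)))" .
  qed
  finally show ?thesis using A by (simp add: entry_norm_def)
qed

lemma operator_norm_le_entry_norm: "operator_norm A \<le> entry_norm A"
  unfolding operator_norm_def
proof (rule cSUP_least)
  have "0\<^sub>v (dim_col A) \<in> {v \<in> carrier_vec (dim_col A). euclidean_norm_vec v \<le> 1}"
    by (simp add: euclidean_norm_vec_def L2_set_def)
  then show "{v \<in> carrier_vec (dim_col A). euclidean_norm_vec v \<le> 1} \<noteq> {}" by blast
qed (auto intro: euclidean_norm_mult_le)

text \<open>The unit vector \<open>unit_vec m j\<close> is sent to column \<open>j\<close>, whose
  Euclidean norm dominates each of its coordinates.\<close>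

lemma entry_le_operator_norm:
  assumes A: "A \<in> carrier_mat n m" and i: "i < n" and j: "j < m"
  shows "cmod (A $$ (i, j)) \<le> operator_norm A"
proof -
  let ?U = "{v \<in> carrier_vec (dim_col A). euclidean_norm_vec v \<le> 1}"
  have "(\<Sum>l<m. (cmod (unit_vec m j $ l))\<^sup>2) = (\<Sum>l<m. if l = j then 1 else 0)"
    by (intro sum.cong) (auto simp: unit_vec_def)
  then have U: "unit_vec m j \<in> ?U"
    using A j by (simp add: euclidean_norm_vec_def L2_set_def)
  have "A *\<^sub>v unit_vec m j = col A j"
    using A j by (auto intro!: eq_vecI)
  then have "cmod (A $$ (i, j)) = cmod ((A *\<^sub>v unit_vec m j) $ i)"
    using A i j by simp
  also have "\<dots> \<le> euclidean_norm_vec (A *\<^sub>v unit_vec m j)"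
    using member_le_L2_set[of "{..<n}" i "\<lambda>l. cmod ((A *\<^sub>v unit_vec m j) $ l)"] A i
    by (simp add: euclidean_norm_vec_def)
  also have "\<dots> \<le> operator_norm A"
    unfolding operator_norm_def
  proof (rule cSUP_upper[OF U])
    show "bdd_above ((\<lambda>v. euclidean_norm_vec (A *\<^sub>v v)) ` ?U)"
      by (rule bdd_aboveI2[where M = "entry_norm A"]) (auto intro: euclidean_norm_mult_le)
  qed
  finally show ?thesis .
qed

lemma entry_norm_le_operator_norm:
  assumes "A \<in> carrier_mat n m"
  shows "entry_norm A \<le> real (n * m) * operator_norm A"
  using assms by (intro entry_norm_le entry_le_operator_norm) auto

lemma operator_norm_nonneg:
  assumes "A \<in> carrier_mat n m" "0 < n" "0 < m"
  shows "0 \<le> operator_norm A"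
  using entry_le_operator_norm[OF assms] norm_ge_zero order_trans by blast

section \<open>Spectral radius and growth of matrix powers\<close>

text \<open>Sum the moduli of the coordinates on both sides of the eigenvector equation, bound each
  coordinate of \<open>v\<close> by their total \<open>?V\<close>, and cancel \<open>?V\<close>,
  which is positive as \<open>v\<close> is nonzero.\<close>

lemma eigenvalue_le_entry_norm:
  assumes M: "M \<in> carrier_mat n n" and ev: "eigenvector M v c"
  shows "cmod c \<le> entry_norm M"
proof -
  have v: "v \<in> carrier_vec n" "v \<noteq> 0\<^sub>v n" "M *\<^sub>v v = c \<cdot>\<^sub>v v"
    using ev M by (auto simp: eigenvector_def)
  let ?V = "\<Sum>j<n. cmod (v $ j)"
  obtain i where i: "i < n" "v $ i \<noteq> 0"
    using v(1,2) by (metis carrier_vecD eq_vecI index_zero_vec)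
  have "0 < cmod (v $ i)" using i by simp
  also have "\<dots> \<le> ?V" using i by (intro member_le_sum) auto
  finally have V: "0 < ?V" .
  have "cmod c * ?V = (\<Sum>i<n. cmod ((M *\<^sub>v v) $ i))"
    using v by (simp add: sum_distrib_left norm_mult)
  also have "\<dots> \<le> (\<Sum>i<n. \<Sum>j<n. cmod (M $$ (i, j)) * ?V)"
  proof (rule sum_mono)
    fix i
    assume i: "i \<in> {..<n}"
    have "(M *\<^sub>v v) $ i = (\<Sum>j<n. M $$ (i, j) * v $ j)"
      using index_mult_mat_vec_sum[OF M v(1)] i by blast
    then have "cmod ((M *\<^sub>v v) $ i) \<le> (\<Sum>j<n. cmod (M $$ (i, j) * v $ j))"
      by (simp add: norm_sum)
    also have "\<dots> \<le> (\<Sum>j<n. cmod (M $$ (i, j)) * ?V)"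
      unfolding norm_mult by (intro sum_mono mult_left_mono member_le_sum) auto
    finally show "cmod ((M *\<^sub>v v) $ i) \<le> (\<Sum>j<n. cmod (M $$ (i, j)) * ?V)" .
  qed
  also have "\<dots> = entry_norm M * ?V"
    using M by (simp add: entry_norm_def sum_distrib_right)
  finally show ?thesis using V by simp
qed

lemma spectral_radius_nonneg:
  assumes "A \<in> carrier_mat n n" "0 < n"
  shows "0 \<le> spectral_radius A"
  using spectral_radius_mem_max(1)[OF assms] by auto

text \<open>If \<open>c\<close> is an eigenvalue of maximal modulus, then \<open>c ^ m\<close> is an
  eigenvalue of the \<open>m\<close>-th power.\<close>

lemma spectral_radius_pow_le_entry_norm:
  assumes A: "A \<in> carrier_mat n n" and n: "0 < n"
  shows "spectral_radius A ^ m \<le> entry_norm (A ^\<^sub>m m)"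
proof -
  obtain c v where c: "spectral_radius A = cmod c" and ev: "eigenvector A v c"
    using spectral_radius_mem_max(1)[OF A n] by (auto simp: spectrum_def eigenvalue_def)
  have "eigenvector (A ^\<^sub>m m) v (c ^ m)"
    using ev eigenvector_pow[OF A ev] A by (auto simp: eigenvector_def)
  from eigenvalue_le_entry_norm[OF pow_carrier_mat[OF A] this] show ?thesis
    by (simp add: c norm_power)
qed

text \<open>Scaling by \<open>1 / t\<close> brings the spectral radius below 1, and powers of such a
  matrix are uniformly bounded, by the Jordan normal form. Undoing the scaling produces the factor
  \<open>t ^ m\<close>.\<close>

lemma pow_mat_entry_bound:
  assumes A: "A \<in> carrier_mat n n" and n: "0 < n" and t: "spectral_radius A < t"
  shows "\<exists>c>0. \<forall>m. \<forall>i<n. \<forall>j<n. cmod ((A ^\<^sub>m m) $$ (i, j)) \<le> c * t ^ m"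
proof -
  have t0: "0 < t" using spectral_radius_nonneg[OF A n] t by simp
  let ?B = "complex_of_real (1 / t) \<cdot>\<^sub>m A"
  have B: "?B \<in> carrier_mat n n" using A by simp
  obtain e v where e: "spectral_radius ?B = cmod e" and ev: "eigenvector ?B v e"
    using spectral_radius_mem_max(1)[OF B n] by (auto simp: spectrum_def eigenvalue_def)
  have v: "v \<in> carrier_vec n" "v \<noteq> 0\<^sub>v n" "?B *\<^sub>v v = e \<cdot>\<^sub>v v"
    using ev A by (auto simp: eigenvector_def)
  \<comment> \<open>An eigenvalue \<open>e\<close> of the scaled matrix gives the eigenvalue
    \<open>t * e\<close> of \<open>A\<close>; for \<open>e\<close> of maximal modulus this forces
    \<open>cmod e < 1\<close>.\<close>
  have "A *\<^sub>v v = (complex_of_real t * e) \<cdot>\<^sub>v v"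
  proof (rule eq_vecI)
    fix i
    assume "i < dim_vec ((complex_of_real t * e) \<cdot>\<^sub>v v)"
    then have i: "i < n" using v by simp
    have "(?B *\<^sub>v v) $ i = complex_of_real (1 / t) * (A *\<^sub>v v) $ i"
      unfolding index_mult_mat_vec_sum[OF A v(1) i] index_mult_mat_vec_sum[OF B v(1) i] sum_distrib_left
      using A i by (intro sum.cong) auto
    then have "(A *\<^sub>v v) $ i = complex_of_real t * (?B *\<^sub>v v) $ i"
      using t0 by (simp del: index_mult_mat_vec)
    then show "(A *\<^sub>v v) $ i = ((complex_of_real t * e) \<cdot>\<^sub>v v) $ i"
      unfolding v(3) using v i by simp
  qed (use A v in simp)
  then have "complex_of_real t * e \<in> spectrum A"
    using A v by (auto simp: spectrum_def eigenvalue_def eigenvector_def)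
  then have "t * cmod e \<le> spectral_radius A"
    using t0 by (intro spectral_radius_mem_max(2)[OF A n]) (auto simp: norm_mult image_iff intro!: bexI)
  then have "t * cmod e < t * 1" using t by simp
  then have "spectral_radius ?B < 1"
    unfolding e using t0 by (simp only: mult_less_cancel_left_pos)
  then obtain c where c: "\<And>m. norm_bound (?B ^\<^sub>m m) c"
    using spectral_radius_jnf_norm_bound_less_1_upper_triangular[OF B] by blast
  \<comment> \<open>Passing from \<open>c\<close> to \<open>\<bar>c\<bar> + 1\<close> makes the
    constant positive, as claimed.\<close>
  have "cmod ((A ^\<^sub>m m) $$ (i, j)) \<le> (\<bar>c\<bar> + 1) * t ^ m" if ij: "i < n" "j < n" for m i j
  proof -
    have "cmod ((?B ^\<^sub>m m) $$ (i, j)) \<le> c"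
      using c[of m] ij unfolding norm_bound_def carrier_matD[OF pow_carrier_mat[OF B]] by blast
    then have "cmod ((A ^\<^sub>m m) $$ (i, j)) / t ^ m \<le> c"
      unfolding pow_smult_mat[OF A] using A ij t0
      by (simp add: norm_mult norm_power norm_divide power_one_over divide_simps)
    then show ?thesis
      using t0 by (simp add: divide_simps) (smt (verit) mult_right_mono zero_less_power)
  qed
  then show ?thesis by (intro exI[of _ "\<bar>c\<bar> + 1"]) auto
qed

section \<open>Comparing the two spectral radii\<close>

text \<open>The summand in the outer spectral radius of the \<open>k\<close>-th Kronecker powers,
  named as a function of \<open>X\<close> because it preserves products and identities.\<close>

definition kronecker_square :: "nat \<Rightarrow> complex mat \<Rightarrow> complex mat" where
  "kronecker_square k X = kronecker (map_mat cnj (kronecker_power X k)) (kronecker_power X k)"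

lemma kronecker_square_carrier:
  assumes "X \<in> carrier_mat n n"
  shows "kronecker_square k X \<in> carrier_mat (n ^ k * n ^ k) (n ^ k * n ^ k)"
  using assms unfolding kronecker_square_def by (intro kronecker_carrier) auto

lemma kronecker_square_one: "kronecker_square k (1\<^sub>m n) = 1\<^sub>m (n ^ k * n ^ k)"
  by (simp add: kronecker_square_def kronecker_power_one_mat map_mat_cnj_one kronecker_one)

lemma kronecker_square_mult:
  assumes "A \<in> carrier_mat n n" "B \<in> carrier_mat n n"
  shows "kronecker_square k (A * B) = kronecker_square k A * kronecker_square k B"
proof -
  note carr = kronecker_power_carrier[OF assms(1), of k] kronecker_power_carrier[OF assms(2), of k]
  show ?thesis
    using carr unfolding kronecker_square_def kronecker_power_mult[OF assms] map_mat_cnj_mult[OF carr]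
    by (intro kronecker_mult) auto
qed

lemma entry_norm_kronecker_square: "entry_norm (kronecker_square k X) = entry_norm X ^ (2 * k)"
  by (simp add: kronecker_square_def entry_norm_kronecker entry_norm_cnj entry_norm_kronecker_power
      power_mult power2_eq_square flip: power_mult_distrib)

locale matrix_tuple =
  fixes n d :: nat and Xs :: "complex mat list"
  assumes n: "1 \<le> n" and d: "1 \<le> d" and len: "length Xs = d" and Xs: "set Xs \<subseteq> carrier_mat n n"
begin

definition S :: "nat \<Rightarrow> complex mat" where
  "S k = foldr (+) (map (kronecker_square k) Xs) (0\<^sub>m (n ^ k * n ^ k) (n ^ k * n ^ k))"

definition outer :: "nat \<Rightarrow> real" where
  "outer k = root k (outer_spectral_radius (n ^ k) (map (\<lambda>X. kronecker_power X k) Xs))"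

text \<open>The sequence whose limit is the joint spectral radius.\<close>

definition growth :: "nat \<Rightarrow> real" where
  "growth m = (SUP w\<in>words d m. root m (operator_norm (word_product n Xs w)))"

lemma word_carrier: "w \<in> words d m \<Longrightarrow> word_product n Xs w \<in> carrier_mat n n"
  using word_product_carrier[OF Xs] len by auto

lemma S_carrier: "S k \<in> carrier_mat (n ^ k * n ^ k) (n ^ k * n ^ k)"
  unfolding S_def using Xs by (intro sum_mat_list(1)) (auto intro: kronecker_square_carrier)

lemma dim_pos: "0 < n ^ k * n ^ k"
  using n by simp

lemma outer_eq:
  assumes "1 \<le> k"
  shows "outer k = root (2 * k) (spectral_radius (S k))"
proof -
  have "map (\<lambda>Y. kronecker (map_mat cnj Y) Y) (map (\<lambda>X. kronecker_power X k) Xs)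
      = map (kronecker_square k) Xs"
    by (simp add: kronecker_square_def)
  then have "outer k = root k (sqrt (spectral_radius (S k)))"
    by (simp only: outer_def outer_spectral_radius_def S_def)
  then show ?thesis
    using assms by (simp add: sqrt_def real_root_mult_exp mult.commute)
qed

lemma outer_nonneg: "0 \<le> outer k"
proof (cases "k = 0")
  case False
  then show ?thesis
    by (simp add: outer_eq real_root_ge_zero spectral_radius_nonneg[OF S_carrier dim_pos])
\<comment> \<open>For \<open>k = 0\<close> the value is 0, since \<open>root 0\<close> is constantly
  0.\<close>
qed (simp add: outer_def)

lemma S_pow_entry:
  assumes "i < n ^ k * n ^ k" "j < n ^ k * n ^ k"
  shows "(S k ^\<^sub>m m) $$ (i, j) = (\<Sum>w\<in>words d m. kronecker_square k (word_product n Xs w) $$ (i, j))"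
proof -
  have "set (map (kronecker_square k) Xs) \<subseteq> carrier_mat (n ^ k * n ^ k) (n ^ k * n ^ k)"
    using Xs by (auto intro: kronecker_square_carrier)
  from pow_sum_mat_list[OF this assms, of m]
  have "(S k ^\<^sub>m m) $$ (i, j) = (\<Sum>w\<in>words d m.
      word_product (n ^ k * n ^ k) (map (kronecker_square k) Xs) w $$ (i, j))"
    by (simp add: S_def len)
  also have "\<dots> = (\<Sum>w\<in>words d m. kronecker_square k (word_product n Xs w) $$ (i, j))"
    using len
    by (intro sum.cong refl arg_cong[where f = "\<lambda>M. M $$ (i, j)"]
        word_product_map[OF Xs _ kronecker_square_one kronecker_square_mult]) auto
  finally show ?thesis .
qed

lemma growth_nonneg: "0 \<le> growth m"
proof -
  obtain w where w: "w \<in> words d m" using words_nonempty[OF d] by blast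
  have "0 \<le> root m (operator_norm (word_product n Xs w))"
    using operator_norm_nonneg[OF word_carrier[OF w]] n by (cases "m = 0") auto
  also have "\<dots> \<le> growth m"
    unfolding growth_def by (intro cSUP_upper[OF w] bdd_above_finite finite_imageI finite_words)
  finally show ?thesis .
qed

lemma operator_norm_word_le:
  assumes "1 \<le> m" and w: "w \<in> words d m"
  shows "operator_norm (word_product n Xs w) \<le> growth m ^ m"
proof -
  have nn: "0 \<le> operator_norm (word_product n Xs w)"
    using operator_norm_nonneg[OF word_carrier[OF w]] n by simp
  have "root m (operator_norm (word_product n Xs w)) \<le> growth m"
    unfolding growth_def by (intro cSUP_upper[OF w] bdd_above_finite finite_imageI finite_words)
  from power_mono[OF this, of m] show ?thesis
    using nn assms(1) by (simp add: real_root_ge_zero)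
qed

text \<open>Bound the entry norm of the \<open>m\<close>-th power of \<open>S k\<close> by the sum
  over all \<open>d ^ m\<close> words, where each word contributes the \<open>2 * k\<close>-th power
  of its own entry norm. Taking \<open>m\<close>-th and then \<open>2 * k\<close>-th roots leaves
  the factor \<open>root m (real (n * n))\<close>, which tends to 1 in \<open>m\<close>.\<close>

lemma outer_le:
  assumes k: "1 \<le> k" and m: "1 \<le> m"
  shows "outer k \<le> root (2 * k) (real d) * (root m (real (n * n)) * growth m)"
proof -
  let ?N = "n ^ k * n ^ k" and ?g = "real (n * n) * growth m ^ m"
  \<comment> \<open>Chosen so that \<open>?t ^ m\<close> is exactly the bound obtained for the entry
    norm, which lets the exponent \<open>m\<close> be cancelled.\<close>
  let ?t = "real d * (root m (real (n * n)) * growth m) ^ (2 * k)"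
  have "spectral_radius (S k) ^ m \<le> entry_norm (S k ^\<^sub>m m)"
    by (rule spectral_radius_pow_le_entry_norm[OF S_carrier dim_pos])
  also have "\<dots> = (\<Sum>i<?N. \<Sum>j<?N. cmod ((S k ^\<^sub>m m) $$ (i, j)))"
    using S_carrier[of k] by (simp add: entry_norm_def)
  also have "\<dots> \<le> (\<Sum>i<?N. \<Sum>j<?N. \<Sum>w\<in>words d m. cmod (kronecker_square k (word_product n Xs w) $$ (i, j)))"
    by (intro sum_mono) (auto simp: S_pow_entry intro: norm_sum)
  also have "\<dots> = (\<Sum>i<?N. \<Sum>w\<in>words d m. \<Sum>j<?N. cmod (kronecker_square k (word_product n Xs w) $$ (i, j)))"
    by (intro sum.cong refl sum.swap)
  also have "\<dots> = (\<Sum>w\<in>words d m. \<Sum>i<?N. \<Sum>j<?N. cmod (kronecker_square k (word_product n Xs w) $$ (i, j)))"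
    by (rule sum.swap)
  also have "\<dots> = (\<Sum>w\<in>words d m. entry_norm (kronecker_square k (word_product n Xs w)))"
    by (intro sum.cong refl)
      (simp only: entry_norm_def carrier_matD[OF kronecker_square_carrier[OF word_carrier]])
  also have "\<dots> \<le> (\<Sum>w\<in>words d m. ?g ^ (2 * k))"
  proof (rule sum_mono)
    fix w
    assume w: "w \<in> words d m"
    have "entry_norm (word_product n Xs w) \<le> real (n * n) * operator_norm (word_product n Xs w)"
      by (rule entry_norm_le_operator_norm[OF word_carrier[OF w]])
    also have "\<dots> \<le> ?g"
      by (intro mult_left_mono operator_norm_word_le[OF m w]) auto
    finally show "entry_norm (kronecker_square k (word_product n Xs w)) \<le> ?g ^ (2 * k)"
      unfolding entry_norm_kronecker_square by (intro power_mono entry_norm_nonneg)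
  qed
  also have "\<dots> = real d ^ m * ?g ^ (2 * k)"
    by (simp add: card_words)
  also have "?g = (root m (real (n * n)) * growth m) ^ m"
    using m by (simp add: power_mult_distrib)
  also have "real d ^ m * \<dots> ^ (2 * k) = ?t ^ m"
    by (simp add: power_mult_distrib mult.commute flip: power_mult)
  finally have "spectral_radius (S k) \<le> ?t"
    using m growth_nonneg by (subst (asm) power_mono_iff)
      (auto intro!: spectral_radius_nonneg[OF S_carrier dim_pos])
  then have "outer k \<le> root (2 * k) ?t"
    using k by (simp add: outer_eq)
  also have "\<dots> = root (2 * k) (real d) * (root m (real (n * n)) * growth m)"
    using k growth_nonneg[of m] by (simp add: real_root_mult real_root_power_cancel)
  finally show ?thesis .
qed

text \<open>The entries of \<open>S k ^\<^sub>m m\<close> at pairs of diagonal double indices are sums of squared moduli,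
  so they dominate the contribution of each single word.\<close>

lemma word_entry_le:
  assumes w: "w \<in> words d m" and pq: "p < n" "q < n"
  shows "\<exists>i<n ^ k * n ^ k. \<exists>j<n ^ k * n ^ k.
    cmod (word_product n Xs w $$ (p, q)) ^ (2 * k) \<le> cmod ((S k ^\<^sub>m m) $$ (i, j))"
proof -
  obtain i j where ij: "i < n ^ k" "j < n ^ k"
    and eq: "kronecker_power (word_product n Xs w) k $$ (i, j) = (word_product n Xs w $$ (p, q)) ^ k"
    using kronecker_power_entry[OF word_carrier[OF w] pq] by blast
  \<comment> \<open>These code the pairs \<open>(i, i)\<close> and \<open>(j, j)\<close>, so the
    entry of each Kronecker square there is \<open>cnj y * y\<close> for one entry \<open>y\<close>
    of the Kronecker power.\<close>
  let ?i = "i * n ^ k + i" and ?j = "j * n ^ k + j"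
  let ?y = "\<lambda>u. kronecker_power (word_product n Xs u) k $$ (i, j)"
  have lt: "?i < n ^ k * n ^ k" "?j < n ^ k * n ^ k"
    and sq: "kronecker_square k (word_product n Xs u) $$ (?i, ?j) = complex_of_real ((cmod (?y u))\<^sup>2)"
    if u: "u \<in> words d m" for u
  proof -
    have Y: "kronecker_power (word_product n Xs u) k \<in> carrier_mat (n ^ k) (n ^ k)"
      by (rule kronecker_power_carrier[OF word_carrier[OF u]])
    then have Y': "map_mat cnj (kronecker_power (word_product n Xs u) k) \<in> carrier_mat (n ^ k) (n ^ k)"
      by simp
    note block = index_kronecker_block[OF Y' Y ij ij]
    show "?i < n ^ k * n ^ k" "?j < n ^ k * n ^ k" by (fact block)+
    show "kronecker_square k (word_product n Xs u) $$ (?i, ?j) = complex_of_real ((cmod (?y u))\<^sup>2)"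
      unfolding kronecker_square_def block(3) complex_norm_square using Y ij
      by (simp add: mult.commute)
  qed
  have "(S k ^\<^sub>m m) $$ (?i, ?j) = complex_of_real (\<Sum>u\<in>words d m. (cmod (?y u))\<^sup>2)"
    unfolding S_pow_entry[OF lt[OF w]] of_real_sum by (intro sum.cong refl sq)
  then have "cmod ((S k ^\<^sub>m m) $$ (?i, ?j)) = (\<Sum>u\<in>words d m. (cmod (?y u))\<^sup>2)"
    by (simp only: norm_of_real) (simp add: sum_nonneg)
  moreover have "(cmod (?y w))\<^sup>2 \<le> (\<Sum>u\<in>words d m. (cmod (?y u))\<^sup>2)"
    by (rule member_le_sum[OF w]) (auto simp: finite_words)
  moreover have "(cmod (?y w))\<^sup>2 = cmod (word_product n Xs w $$ (p, q)) ^ (2 * k)"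
    by (simp add: eq norm_power mult.commute flip: power_mult)
  ultimately have "cmod (word_product n Xs w $$ (p, q)) ^ (2 * k) \<le> cmod ((S k ^\<^sub>m m) $$ (?i, ?j))"
    by (simp only:)
  then show ?thesis using lt[OF w] by blast
qed

text \<open>Every word entry is controlled by an entry of the \<open>m\<close>-th power of
  \<open>S k\<close>, which is at most a constant times \<open>(s ^ (2 * k)) ^ m\<close> for any
  \<open>s\<close> above \<open>outer k\<close>. After \<open>m\<close>-th roots the constants tend
  to 1.\<close>

lemma growth_eventually_le:
  assumes k: "1 \<le> k" and e: "0 < e"
  shows "\<forall>\<^sub>F m in sequentially. growth m \<le> outer k + e"
proof -
  \<comment> \<open>The other half of \<open>e\<close> absorbs the factor \<open>root m D\<close>,
    which is close to 1 only for large \<open>m\<close>.\<close>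
  define s where "s = outer k + e / 2"
  have s: "0 < s" "outer k < s" using outer_nonneg[of k] e by (auto simp: s_def)
  have "spectral_radius (S k) = outer k ^ (2 * k)"
    using k by (simp add: outer_eq spectral_radius_nonneg[OF S_carrier dim_pos])
  also have "\<dots> < s ^ (2 * k)"
    using s outer_nonneg k by (intro power_strict_mono) auto
  finally obtain c where c: "0 < c"
    and bound: "\<And>m i j. i < n ^ k * n ^ k \<Longrightarrow> j < n ^ k * n ^ k \<Longrightarrow>
      cmod ((S k ^\<^sub>m m) $$ (i, j)) \<le> c * (s ^ (2 * k)) ^ m"
    using pow_mat_entry_bound[OF S_carrier dim_pos] by blast
  \<comment> \<open>The factor \<open>n * n\<close> counts the entries of a word, and the
    \<open>2 * k\<close>-th root of \<open>c\<close> comes from undoing the Kronecker square;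
    \<open>D\<close> does not depend on \<open>m\<close>.\<close>
  define D where "D = real (n * n) * root (2 * k) c"
  have D: "0 < D" using n k c by (simp add: D_def)
  have "growth m \<le> root m D * s" if m: "1 \<le> m" for m
    unfolding growth_def
  proof (rule cSUP_least[OF words_nonempty[OF d]])
    fix w
    assume w: "w \<in> words d m"
    have "cmod (word_product n Xs w $$ (p, q)) \<le> root (2 * k) c * s ^ m" if pq: "p < n" "q < n" for p q
    proof -
      obtain i j where ij: "i < n ^ k * n ^ k" "j < n ^ k * n ^ k"
        and le: "cmod (word_product n Xs w $$ (p, q)) ^ (2 * k) \<le> cmod ((S k ^\<^sub>m m) $$ (i, j))"
        using word_entry_le[OF w pq] by blast
      note le
      also have "cmod ((S k ^\<^sub>m m) $$ (i, j)) \<le> c * (s ^ (2 * k)) ^ m" by (rule bound[OF ij])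
      also have "\<dots> = (root (2 * k) c * s ^ m) ^ (2 * k)"
        using k c by (simp add: power_mult_distrib mult.commute flip: power_mult)
      finally show ?thesis
        using k c s by (subst (asm) power_mono_iff) auto
    qed
    from entry_norm_le[OF word_carrier[OF w] this]
    have "operator_norm (word_product n Xs w) \<le> D * s ^ m"
      using operator_norm_le_entry_norm[of "word_product n Xs w"] by (simp add: D_def mult_ac)
    then have "root m (operator_norm (word_product n Xs w)) \<le> root m (D * s ^ m)"
      using m by simp
    also have "\<dots> = root m D * s"
      using m s by (simp add: real_root_mult real_root_power_cancel)
    finally show "root m (operator_norm (word_product n Xs w)) \<le> root m D * s" .
  qed
  moreover have "\<forall>\<^sub>F m in sequentially. root m D * s < outer k + e"
  proof (rule order_tendstoD(2))
    show "(\<lambda>m. root m D * s) \<longlonglongrightarrow> 1 * s"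
      by (intro tendsto_intros LIMSEQ_root_const D)
    show "1 * s < outer k + e" using e by (simp add: s_def)
  qed
  ultimately show ?thesis
    using eventually_ge_at_top[of 1]
    by (smt (verit, ccfv_threshold) eventually_elim2)
qed

end

section \<open>Convergence of both sequences from the two bounds\<close>

text \<open>Here \<open>h\<close> stands for \<open>outer\<close> and \<open>r\<close> for
  \<open>growth\<close>, while \<open>a\<close> and \<open>b\<close> carry the error factors. The
  common limit is the infimum of \<open>h\<close>: \<open>upper\<close> keeps \<open>r\<close>
  eventually below anything larger, and \<open>lower\<close> bounds \<open>r\<close> from below when
  its \<open>k\<close> tends to infinity. Then \<open>lower\<close> with \<open>m\<close> tending to
  infinity traps \<open>h\<close>.\<close>

lemma tendsto_of_mutual_bounds:
  fixes h r a b :: "nat \<Rightarrow> real"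
  assumes h: "\<And>k. 0 \<le> h k"
    and a: "a \<longlonglongrightarrow> 1" "\<And>k. 1 \<le> k \<Longrightarrow> 0 < a k" and b: "b \<longlonglongrightarrow> 1" "\<And>m. 1 \<le> m \<Longrightarrow> 0 < b m"
    and lower: "\<And>k m. 1 \<le> k \<Longrightarrow> 1 \<le> m \<Longrightarrow> h k \<le> a k * (b m * r m)"
    and upper: "\<And>k e. 1 \<le> k \<Longrightarrow> 0 < e \<Longrightarrow> \<forall>\<^sub>F m in sequentially. r m \<le> h k + e"
  obtains L where "r \<longlonglongrightarrow> L" "h \<longlonglongrightarrow> L" "\<And>k. 1 \<le> k \<Longrightarrow> L \<le> h k" "\<And>k. 1 \<le> k \<Longrightarrow> h k \<le> a k * L"
proof
  define L where "L = (INF k\<in>{1..}. h k)"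
  have bdd: "bdd_below (h ` {1..})" using h by (auto intro!: bdd_belowI2)
  show L_le: "L \<le> h k" if "1 \<le> k" for k
    unfolding L_def using that by (intro cINF_lower bdd) auto
  have L_le_r: "L / b m \<le> r m" if m: "1 \<le> m" for m
  proof -
    \<comment> \<open>With \<open>m\<close> fixed,
      \<open>L \<le> h k \<le> a k * (b m * r m)\<close> for all \<open>k \<ge> 1\<close>, and
      \<open>a k\<close> tends to 1.\<close>
    have "L \<le> 1 * (b m * r m)"
    proof (rule LIMSEQ_le_const)
      show "(\<lambda>k. a k * (b m * r m)) \<longlonglongrightarrow> 1 * (b m * r m)" by (intro tendsto_intros a)
      show "\<exists>N. \<forall>k\<ge>N. L \<le> a k * (b m * r m)"
        using L_le lower m by (intro exI[of _ 1]) (metis order_trans)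
    qed
    then show ?thesis using b(2)[OF m] by (simp add: field_simps)
  qed
  show r: "r \<longlonglongrightarrow> L"
  proof (rule order_tendstoI)
    fix x
    assume "x < L"
    moreover have "(\<lambda>m. L / b m) \<longlonglongrightarrow> L / 1" by (intro tendsto_intros b) simp
    ultimately have "\<forall>\<^sub>F m in sequentially. x < L / b m" by (intro order_tendstoD(1)) auto
    then show "\<forall>\<^sub>F m in sequentially. x < r m"
      using eventually_ge_at_top[of 1] by eventually_elim (metis L_le_r less_le_trans)
  next
    fix x
    assume "L < x"
    then obtain k where k: "1 \<le> k" "h k < x"
      unfolding L_def using cINF_less_iff[OF _ bdd] by auto
    \<comment> \<open>The midpoint of \<open>h k\<close> and \<open>x\<close> gives the strict
      inequality below \<open>x\<close>.\<close>
    have "\<forall>\<^sub>F m in sequentially. r m \<le> h k + (x - h k) / 2"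
      using k by (intro upper) auto
    then show "\<forall>\<^sub>F m in sequentially. r m < x"
      by eventually_elim (use k in \<open>simp add: field_simps\<close>)
  qed
  show h_le: "h k \<le> a k * L" if k: "1 \<le> k" for k
  proof -
    have "h k \<le> a k * (1 * L)"
    proof (rule LIMSEQ_le_const)
      show "(\<lambda>m. a k * (b m * r m)) \<longlonglongrightarrow> a k * (1 * L)" by (intro tendsto_intros b r)
      show "\<exists>N. \<forall>m\<ge>N. h k \<le> a k * (b m * r m)" using lower[OF k] by blast
    qed
    then show ?thesis by simp
  qed
  show "h \<longlonglongrightarrow> L"
  proof (rule tendsto_sandwich[where f = "\<lambda>_. L" and h = "\<lambda>k. a k * L"])
    show "(\<lambda>k. a k * L) \<longlonglongrightarrow> L" using tendsto_mult_right[OF a(1), of L] by simp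
  qed (auto intro!: eventually_sequentiallyI[of 1] L_le h_le)
qed

theorem corollary1p6:
  fixes n d :: nat and Xs :: "complex mat list"
  assumes "1 \<le> n" and "1 \<le> d"
    and "length Xs = d" and "set Xs \<subseteq> carrier_mat n n"
  shows "(\<forall>k::nat. 1 \<le> k \<longrightarrow>
            1 / root (2 * k) (real d)
                * root k (outer_spectral_radius (n ^ k) (map (\<lambda>X. kronecker_power X k) Xs))
              \<le> joint_spectral_radius n Xs
          \<and> joint_spectral_radius n Xs
              \<le> root k (outer_spectral_radius (n ^ k) (map (\<lambda>X. kronecker_power X k) Xs)))
       \<and> (\<lambda>k::nat. root k (outer_spectral_radius (n ^ k) (map (\<lambda>X. kronecker_power X k) Xs)))
            \<longlonglongrightarrow> joint_spectral_radius n Xs"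
proof -
  interpret matrix_tuple n d Xs using assms by unfold_locales
  \<comment> \<open>A subsequence of \<open>root k (real d)\<close>, along the even indices.\<close>
  have root_d: "(\<lambda>k. root (2 * k) (real d)) \<longlonglongrightarrow> 1"
    using LIMSEQ_subseq_LIMSEQ[OF LIMSEQ_root_const[of "real d"], of "\<lambda>k. 2 * k"] d
    by (simp add: strict_mono_def comp_def)
  obtain L where L: "growth \<longlonglongrightarrow> L" "outer \<longlonglongrightarrow> L" "\<And>k. 1 \<le> k \<Longrightarrow> L \<le> outer k"
    "\<And>k. 1 \<le> k \<Longrightarrow> outer k \<le> root (2 * k) (real d) * L"
    by (rule tendsto_of_mutual_bounds[OF outer_nonneg root_d _ LIMSEQ_root_const _ outer_le growth_eventually_le])
      (use n d in auto)
  \<comment> \<open>The definition uses \<open>lim\<close>, so its value is known once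
    \<open>growth\<close> has been shown to converge.\<close>
  have jsr: "joint_spectral_radius n Xs = L"
    using limI[OF L(1)] by (simp add: joint_spectral_radius_def growth_def[abs_def] len)
  have "1 / root (2 * k) (real d) * outer k \<le> L" if "1 \<le> k" for k
    using L(4)[OF that] that d by (simp add: divide_simps mult.commute)
  then show ?thesis
    using L(2,3) unfolding jsr outer_def[abs_def] by blast
qed

end
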